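(* Let $k$ be a field of characteristic zero, let $A$ be an associative unital $k$-algebra, let $\phi:A\to k$ be a unital linear map, and let $\Phi:\overline T(T(A))\to k$ be its multiplicative extension. Let $\kappa:\overline T(T(A))\to k$ be the infinitesimal character solving $\Phi=e+\kappa\prec\Phi$. For $a\in A$ set $k_n:=\kappa(a^{\otimes n})$ for $n\ge1$ and $m_n:=\Phi(a^{\otimes n})=\phi(a^n)$ for $n\ge0$. Then for all $n\ge 1$ $$m_n=\sum_{s=1}^n\ \sum_{\substack{i_1+\cdots+i_s=n-s\\ i_1,\dots,i_s\ge0}}k_s\,m_{i_1}\cdots m_{i_s}.$$ In particular, the $k_n$ are the free cumulants of $a\in(A,\phi)$.
   Context: **The bialgebra.** $T(A):=\bigoplus_{n>0}A^{\otimes n}$, with elements written as words $a_1\cdots a_n$; $a^{\otimes n}$ denotes the word $a\cdots a$ of length $n$, and $a^n$ the $n$-th power in $A$ ($a^{\otimes0}=\mathbf 1$, $a^0=1_A$). $T(T(A)):=\bigoplus_{n>0}T(A)^{\otimes n}$ and $\overline T(T(A)):=\bigoplus_{n\ge0}T(A)^{\otimes n}=T(T(A))\oplus k\mathbf 1$, with elements written with bars $w_1|\cdots|w_n$ ($w_i\in T(A)$); the product is bar-concatenation. For a word $a_1\cdots a_n$ and $S=\{s_1<\cdots<s_p\}\subseteq[n]=\{1,\dots,n\}$, put $a_S:=a_{s_1}\cdots a_{s_p}$, $a_\emptyset:=\mathbf 1$. Let $J_1,\dots,J_r$ be the maximal runs of consecutive integers in $[n]-S$, in increasing order; put $a_{J^S_{[n]}}:=a_{J_1}|\cdots|a_{J_r}$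 (equal to $\mathbf 1$ if $S=[n]$). The coproduct is $\Delta(a_1\cdots a_n):=\sum_{S\subseteq[n]}a_S\otimes a_{J^S_{[n]}}$, extended by $\Delta(w_1|\cdots|w_m):=\Delta(w_1)\cdots\Delta(w_m)$, $\Delta(\mathbf 1)=\mathbf 1\otimes\mathbf 1$. Further $\Delta^+_\prec(a_1\cdots a_n):=\sum_{1\in S\subseteq[n]}a_S\otimes a_{J^S_{[n]}}$, $\Delta^+_\prec(w_1|\cdots|w_m):=\Delta^+_\prec(w_1)\Delta(w_2)\cdots\Delta(w_m)$, and $\Delta_\prec(b):=\Delta^+_\prec(b)-b\otimes\mathbf 1$ for $b\in T(T(A))$. **Half-convolution.** $e:\overline T(T(A))\to k$ is the augmentation (identity on $T(A)^{\otimes 0}=k$, zero on $T(T(A))$). For linear forms $f,g$ on $\overline T(T(A))$ vanishing on $\mathbf 1$, $f\prec g$ vanishes on $\mathbf 1$ and equals $m_k\circ(f\otimes g)\circ\Delta_\prec$ on $T(T(A))$ ($m_k$ the product of $k$); also $f\prec e:=f$, extended linearly. Thus for $f(\mathbf 1)=0$, $g(\mathbf 1)=1$, $f\prec g=m_k\circ(f\otimes g)\circ\Delta^+_\prec$ on $T(T(A))$. **Extension of $\phi$.** $\phi$ is extended to $T(A)$ by $\phi(a_1a_2\cdots a_n):=\phi(a_1\cdot_A a_2\cdot_A\cdots\cdot_A a_n)$, where $\cdot_A$ is the product in $A$, and then $\Phi(\mathbf 1):=1$, $\Phi(w_1|\cdots|w_m):=\phi(w_1)\cdots\phi(w_m)$.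 **Infinitesimal character.** A linear form $\kappa$ on $\overline T(T(A))$ with $\kappa(\mathbf 1)=0$ and $\kappa(b|c)=0$ for all $b,c\in T(T(A))$. For every such $\Phi$ there is a unique infinitesimal character $\kappa$ with $\Phi=e+\kappa\prec\Phi$. **Free cumulants (single variable).** For $a\in A$ with moments $m_n=\phi(a^n)$, the free cumulants are the scalars $(k_n)_{n\ge1}$ determined by the identity of formal power series $C(zM(z))=M(z)$, where $C(z)=1+\sum_{n\ge1}k_nz^n$ and $M(z)=1+\sum_{n\ge1}m_nz^n$. *)

theory Defs
  imports
    "HOL-Library.Poly_Mapping"
    "HOL-Library.Product_Plus"
    "HOL-Computational_Algebra.Formal_Power_Series"
begin

section \<open>Associative unital algebras over a field\<close>

locale unital_algebra = vector_space scale
  for scale :: "'k::field \<Rightarrow> 'a::ring_1 \<Rightarrow> 'a" +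
  assumes mult_scale_left: "scale c x * y = scale c (x * y)"
    and mult_scale_right: "x * scale c y = scale c (x * y)"


section \<open>Free vector spaces and linear extension\<close>

text \<open>The free vector space on a type \<open>'x\<close> over \<open>'k\<close> is \<open>'x \<Rightarrow>\<^sub>0 'k\<close>.\<close>

definition free_scale :: "'k::field \<Rightarrow> ('x \<Rightarrow>\<^sub>0 'k) \<Rightarrow> ('x \<Rightarrow>\<^sub>0 'k)" where
  "free_scale c p = Poly_Mapping.map (\<lambda>x. c * x) p"

definition basis :: "'x \<Rightarrow> ('x \<Rightarrow>\<^sub>0 'k::field)" where
  "basis x = Poly_Mapping.single x 1"

definition lin_ext :: "('k::field \<Rightarrow> 'v::ab_group_add \<Rightarrow> 'v) \<Rightarrow> ('x \<Rightarrow> 'v) \<Rightarrow> ('x \<Rightarrow>\<^sub>0 'k) \<Rightarrow> 'v" where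
  "lin_ext s f p = (\<Sum>x\<in>Poly_Mapping.keys p. s (Poly_Mapping.lookup p x) (f x))"

lemma lookup_free_scale [simp]:
  "Poly_Mapping.lookup (free_scale c p) x = c * Poly_Mapping.lookup p x"
  by (simp add: free_scale_def Poly_Mapping.map.rep_eq when_def)

lemma vector_space_free_scale: "vector_space free_scale"
  by unfold_locales (auto intro!: poly_mapping_eqI simp: lookup_add algebra_simps)

lemma lin_ext_superset:
  assumes "vector_space s" "finite X" "Poly_Mapping.keys p \<subseteq> X"
  shows "lin_ext s f p = (\<Sum>x\<in>X. s (Poly_Mapping.lookup p x) (f x))"
proof -
  interpret vector_space s by fact
  show ?thesis unfolding lin_ext_def
    by (rule sum.mono_neutral_left) (use assms in \<open>auto simp: in_keys_iff\<close>)
qed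

lemma linear_lin_ext:
  assumes "vector_space s"
  shows "Vector_Spaces.linear free_scale s (lin_ext s f)"
proof -
  interpret vector_space s by fact
  have add: "lin_ext s f (p + q) = lin_ext s f p + lin_ext s f q" for p q
  proof -
    let ?X = "Poly_Mapping.keys p \<union> Poly_Mapping.keys q"
    have "Poly_Mapping.keys (p + q) \<subseteq> ?X" by (rule Poly_Mapping.keys_add)
    then show ?thesis
      by (simp add: lin_ext_superset[OF assms, of ?X] lookup_add scale_left_distrib sum.distrib)
  qed
  have sc: "lin_ext s f (free_scale c p) = s c (lin_ext s f p)" for c p
  proof -
    have "Poly_Mapping.keys (free_scale c p) \<subseteq> Poly_Mapping.keys p" by (auto simp: in_keys_iff)
    then show ?thesis
      by (simp add: lin_ext_superset[OF assms, of "Poly_Mapping.keys p"] scale_sum_right)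
  qed
  show ?thesis
    by (intro Vector_Spaces.linear_iff[THEN iffD2] conjI allI)
       (use add sc in \<open>auto intro: vector_space_free_scale assms\<close>)
qed

lemma lin_ext_basis:
  assumes "vector_space s"
  shows "lin_ext s f (basis x) = f x"
proof -
  interpret vector_space s by fact
  show ?thesis by (simp add: lin_ext_def basis_def)
qed

lemma vector_space_mult: "vector_space ((*) :: 'k::field \<Rightarrow> _)"
  by unfold_locales (auto simp: algebra_simps)

text \<open>
  Lists form a monoid under concatenation, so that \<open>'v list \<Rightarrow>\<^sub>0 'k\<close> and
  \<open>('v list \<times> 'v list) \<Rightarrow>\<^sub>0 'k\<close> carry the algebra structure with
  \<open>basis u * basis v = basis (u @ v)\<close>, respectively
  \<open>basis (u, u') * basis (v, v') = basis (u @ v, u' @ v')\<close>, and unit \<open>basis []\<close>,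
  respectively \<open>basis ([], [])\<close>.
\<close>

instantiation list :: (type) monoid_add
begin
definition zero_list :: "'a list" where "zero_list = []"
definition plus_list :: "'a list \<Rightarrow> 'a list \<Rightarrow> 'a list" where "plus_list xs ys = xs @ ys"
instance by standard (simp_all add: zero_list_def plus_list_def)
end


section \<open>Tensor algebras\<close>

text \<open>
  A quotient vector space is given by a vector space together with the subspace
  that is divided out; linear forms on the quotient are the linear forms that vanish on the
  subspace.

  For a vector space \<open>V\<close>, given as the quotient by a subspace \<open>N\<close> of the type \<open>'v\<close> with scalar
  multiplication \<open>s\<close>, the direct sum of the tensor powers of \<open>V\<close> is the quotient of the free
  vector space on tuples of elements of \<open>'v\<close> by the relations saying that the tuple depends linearly
  on each entry, and only on the class of each entry modulo \<open>N\<close>.  The parameter \<open>emb\<close> turns a list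
  into a tuple: it is \<open>\<lambda>w. w\<close> when the tensor power of degree 0 is included, and \<open>Word\<close> (the
  constructor of nonempty lists) when only positive degrees are taken.
\<close>

definition tensor_relations ::
  "('v list \<Rightarrow> 't) \<Rightarrow> ('k::field \<Rightarrow> 'v::ab_group_add \<Rightarrow> 'v) \<Rightarrow> 'v set \<Rightarrow> ('t \<Rightarrow>\<^sub>0 'k) set" where
  "tensor_relations emb s N = module.span free_scale
     ({basis (emb (us @ (x + y) # vs)) - basis (emb (us @ x # vs)) - basis (emb (us @ y # vs))
         | us x y vs. True}
    \<union> {basis (emb (us @ s c x # vs)) - free_scale c (basis (emb (us @ x # vs)))
         | us c x vs. True}
    \<union> {basis (emb (us @ x # vs)) | us x vs. x \<in> N})"

lemma linear_form_vanishes_on_tensor_relations: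
  fixes f :: "('t \<Rightarrow>\<^sub>0 'k::field) \<Rightarrow> 'k"
  assumes "Vector_Spaces.linear free_scale (*) f"
   "\<And>us x y vs. f (basis (emb (us @ (x + y) # vs))) = f (basis (emb (us @ x # vs))) + f (basis (emb (us @ y # vs)))"
   "\<And>us c x vs. f (basis (emb (us @ s c x # vs))) = c * f (basis (emb (us @ x # vs)))"
   "\<And>us x vs. x \<in> N \<Longrightarrow> f (basis (emb (us @ x # vs))) = 0"
   and r: "r \<in> tensor_relations emb s N"
  shows "f r = 0"
proof -
  interpret fs: vector_space "free_scale :: 'k \<Rightarrow> ('t \<Rightarrow>\<^sub>0 'k) \<Rightarrow> _" by (rule vector_space_free_scale)
  interpret l: Vector_Spaces.linear free_scale "(*)" f by fact
  show ?thesis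
    using r unfolding tensor_relations_def
  proof (induction rule: fs.span_induct)
    case base
    show ?case by (simp add: fs.subspace_def l.add l.scale l.zero)
  next
    case (step x)
    then consider
        (add) us y z vs where "x = basis (emb (us @ (y + z) # vs))
           - basis (emb (us @ y # vs)) - basis (emb (us @ z # vs))"
      | (scale) us c y vs where "x = basis (emb (us @ s c y # vs))
           - free_scale c (basis (emb (us @ y # vs)))"
      | (null) us y vs where "x = basis (emb (us @ y # vs))" "y \<in> N"
      by blast
    then show ?case
      by cases (simp_all only: l.diff l.scale assms(2-4) add_diff_cancel_left' diff_self)
  qed
qed

typedef 'a word = "{w :: 'a list. w \<noteq> []}"
  morphisms letters Word
  by (rule exI[of _ "[undefined]"]) simp

text \<open>
  \<open>T(A)\<close> is \<open>('a, 'k) T\<close> modulo \<open>T_relations\<close>.  Its tensor algebra, the space \<open>T(T(A))\<close> together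
  with the scalars, is \<open>('a, 'k) TT\<close> modulo \<open>TT_relations\<close>; the bar-word \<open>w\<^sub>1|\<dots>|w\<^sub>m\<close> is
  \<open>basis [w\<^sub>1, \<dots>, w\<^sub>m]\<close> and the product of \<open>('a, 'k) TT\<close> is bar-concatenation.
\<close>

type_synonym ('a, 'k) T = "'a word \<Rightarrow>\<^sub>0 'k"
type_synonym ('a, 'k) TT = "('a, 'k) T list \<Rightarrow>\<^sub>0 'k"
type_synonym ('a, 'k) TT_tensor_TT = "(('a, 'k) T list \<times> ('a, 'k) T list) \<Rightarrow>\<^sub>0 'k"

definition T_relations :: "('k::field \<Rightarrow> 'a::ring_1 \<Rightarrow> 'a) \<Rightarrow> ('a, 'k) T set" where
  "T_relations scale = tensor_relations Word scale {0}"

definition TT_relations :: "('k::field \<Rightarrow> 'a::ring_1 \<Rightarrow> 'a) \<Rightarrow> ('a, 'k) TT set" where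
  "TT_relations scale = tensor_relations (\<lambda>w. w) free_scale (T_relations scale)"

definition linear_form_TT :: "('k::field \<Rightarrow> 'a::ring_1 \<Rightarrow> 'a) \<Rightarrow> (('a, 'k) TT \<Rightarrow> 'k) \<Rightarrow> bool" where
  "linear_form_TT scale f \<longleftrightarrow>
     Vector_Spaces.linear free_scale (*) f \<and> (\<forall>r\<in>TT_relations scale. f r = 0)"

text \<open>The subspace \<open>T(T(A))\<close>, and the projection onto it along the scalars.\<close>

definition TT_plus :: "('a, 'k::field) TT set" where
  "TT_plus = {b. Poly_Mapping.lookup b [] = 0}"

definition augmentation :: "('a, 'k::field) TT \<Rightarrow> 'k" where
  "augmentation b = Poly_Mapping.lookup b []"

definition proj_plus :: "('a, 'k::field) TT \<Rightarrow> ('a, 'k) TT" where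
  "proj_plus b = b - free_scale (augmentation b) 1"

text \<open>The word \<open>a\<^sub>1\<dots>a\<^sub>n\<close> as a bar-word with at most one factor; the empty word is the unit.\<close>

definition bar_of_word :: "'a list \<Rightarrow> ('a, 'k::field) T list" where
  "bar_of_word w = (if w = [] then [] else [basis (Word w)])"


section \<open>The coproduct\<close>

definition is_run :: "nat set \<Rightarrow> bool" where
  "is_run J \<longleftrightarrow> (\<exists>i j. i \<le> j \<and> J = {i..j})"

definition maximal_runs :: "nat set \<Rightarrow> nat set set" where
  "maximal_runs U =
     {J. is_run J \<and> J \<subseteq> U \<and> (\<forall>J'. is_run J' \<and> J \<subseteq> J' \<and> J' \<subseteq> U \<longrightarrow> J' = J)}"

definition run_list :: "nat set \<Rightarrow> nat set list" where
  "run_list U = sorted_key_list_of_set Min (maximal_runs U)"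

text \<open>Positions in words are counted from 1.\<close>

definition subword :: "'a list \<Rightarrow> nat set \<Rightarrow> 'a list" where
  "subword w S = map (\<lambda>i. w ! (i - 1)) (sorted_list_of_set S)"

definition coproduct_term :: "'a list \<Rightarrow> nat set \<Rightarrow> ('a, 'k::field) TT_tensor_TT" where
  "coproduct_term w S =
     basis (bar_of_word (subword w S),
            map (\<lambda>J. basis (Word (subword w J))) (run_list ({1..length w} - S)))"

definition coproduct_T :: "('a, 'k::field) T \<Rightarrow> ('a, 'k) TT_tensor_TT" where
  "coproduct_T = lin_ext free_scale
     (\<lambda>w. \<Sum>S | S \<subseteq> {1..length (letters w)}. coproduct_term (letters w) S)"

definition coproduct_prec_plus_T :: "('a, 'k::field) T \<Rightarrow> ('a, 'k) TT_tensor_TT" where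
  "coproduct_prec_plus_T = lin_ext free_scale
     (\<lambda>w. \<Sum>S | 1 \<in> S \<and> S \<subseteq> {1..length (letters w)}. coproduct_term (letters w) S)"

definition coproduct :: "('a, 'k::field) TT \<Rightarrow> ('a, 'k) TT_tensor_TT" where
  "coproduct = lin_ext free_scale (\<lambda>ws. prod_list (map coproduct_T ws))"

text \<open>
  The next two maps are only meaningful on \<open>TT_plus\<close>, where the case \<open>[]\<close> does not occur.
\<close>

definition coproduct_prec_plus :: "('a, 'k::field) TT \<Rightarrow> ('a, 'k) TT_tensor_TT" where
  "coproduct_prec_plus = lin_ext free_scale
     (\<lambda>ws. case ws of [] \<Rightarrow> 0 | v # vs \<Rightarrow> coproduct_prec_plus_T v * coproduct (basis vs))"

definition coproduct_prec :: "('a, 'k::field) TT \<Rightarrow> ('a, 'k) TT_tensor_TT" where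
  "coproduct_prec b = coproduct_prec_plus b - lin_ext free_scale (\<lambda>ws. basis (ws, [])) b"


section \<open>Half-convolution and infinitesimal characters\<close>

text \<open>The composition of \<open>f \<otimes> g\<close> with the product of the field.\<close>

definition tensor_form ::
  "(('a, 'k::field) TT \<Rightarrow> 'k) \<Rightarrow> (('a, 'k) TT \<Rightarrow> 'k) \<Rightarrow> ('a, 'k) TT_tensor_TT \<Rightarrow> 'k" where
  "tensor_form f g = lin_ext (*) (\<lambda>(u, v). f (basis u) * g (basis v))"

text \<open>The case of linear forms that both vanish on the unit.\<close>

definition half_conv0 ::
  "(('a, 'k::field) TT \<Rightarrow> 'k) \<Rightarrow> (('a, 'k) TT \<Rightarrow> 'k) \<Rightarrow> ('a, 'k) TT \<Rightarrow> 'k" where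
  "half_conv0 f g b = tensor_form f g (coproduct_prec (proj_plus b))"

text \<open>
  A form \<open>g\<close> decomposes as \<open>g 1\<close> times the augmentation plus a form vanishing on the unit; the
  augmentation acts on the right as the identity.
\<close>

definition half_conv ::
  "(('a, 'k::field) TT \<Rightarrow> 'k) \<Rightarrow> (('a, 'k) TT \<Rightarrow> 'k) \<Rightarrow> ('a, 'k) TT \<Rightarrow> 'k" where
  "half_conv f g b = g 1 * f b + half_conv0 f (\<lambda>c. g c - g 1 * augmentation c) b"

definition infinitesimal_character ::
  "('k::field \<Rightarrow> 'a::ring_1 \<Rightarrow> 'a) \<Rightarrow> (('a, 'k) TT \<Rightarrow> 'k) \<Rightarrow> bool" where
  "infinitesimal_character scale \<kappa> \<longleftrightarrow>
     linear_form_TT scale \<kappa> \<and> \<kappa> 1 = 0 \<and> (\<forall>b\<in>TT_plus. \<forall>c\<in>TT_plus. \<kappa> (b * c) = 0)"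

definition extend_T :: "('a::ring_1 \<Rightarrow> 'k::field) \<Rightarrow> ('a, 'k) T \<Rightarrow> 'k" where
  "extend_T \<phi> = lin_ext (*) (\<lambda>w. \<phi> (prod_list (letters w)))"

definition multiplicative_extension :: "('a::ring_1 \<Rightarrow> 'k::field) \<Rightarrow> ('a, 'k) TT \<Rightarrow> 'k" where
  "multiplicative_extension \<phi> = lin_ext (*) (\<lambda>ws. prod_list (map (extend_T \<phi>) ws))"

lemma linear_form_TT_multiplicative_extension:
  fixes scale :: "'k::field \<Rightarrow> 'a::ring_1 \<Rightarrow> 'a"
  assumes "unital_algebra scale" "Vector_Spaces.linear scale (*) \<phi>"
  shows "linear_form_TT scale (multiplicative_extension \<phi>)"
proof -
  interpret unital_algebra scale by fact
  interpret p: Vector_Spaces.linear scale "(*)" \<phi> by fact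
  have lT: "Vector_Spaces.linear free_scale (*) (extend_T \<phi>)"
    unfolding extend_T_def by (rule linear_lin_ext[OF vector_space_mult])
  interpret e: Vector_Spaces.linear free_scale "(*)" "extend_T \<phi>" by fact
  have lM: "Vector_Spaces.linear free_scale (*) (multiplicative_extension \<phi>)"
    unfolding multiplicative_extension_def by (rule linear_lin_ext[OF vector_space_mult])
  have T0: "extend_T \<phi> r = 0" if "r \<in> T_relations scale" for r
    by (rule linear_form_vanishes_on_tensor_relations[OF lT _ _ _ that[unfolded T_relations_def]])
      (simp_all add: extend_T_def lin_ext_basis[OF vector_space_mult] Word_inverse algebra_simps
         p.add p.scale p.zero mult_scale_left mult_scale_right)
  have M: "multiplicative_extension \<phi> (basis (us @ x # vs)) =
      prod_list (map (extend_T \<phi>) us) * (extend_T \<phi> x * prod_list (map (extend_T \<phi>) vs))" for us x vs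
    by (simp add: multiplicative_extension_def lin_ext_basis[OF vector_space_mult])
  have "multiplicative_extension \<phi> r = 0" if "r \<in> TT_relations scale" for r
  proof (rule linear_form_vanishes_on_tensor_relations[OF lM _ _ _ that[unfolded TT_relations_def]])
    fix us vs and x y :: "('a, 'k) T" and c :: 'k
    show "multiplicative_extension \<phi> (basis (us @ (x + y) # vs)) =
        multiplicative_extension \<phi> (basis (us @ x # vs)) + multiplicative_extension \<phi> (basis (us @ y # vs))"
      unfolding M e.add by (simp only: distrib_left distrib_right)
    show "multiplicative_extension \<phi> (basis (us @ free_scale c x # vs)) =
        c * multiplicative_extension \<phi> (basis (us @ x # vs))"
      unfolding M e.scale by (simp only: ac_simps)
    show "multiplicative_extension \<phi> (basis (us @ x # vs)) = 0" if "x \<in> T_relations scale"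
      unfolding M T0[OF that] by simp
  qed
  with lM show ?thesis by (simp add: linear_form_TT_def)
qed

definition tensor_power :: "'a \<Rightarrow> nat \<Rightarrow> ('a, 'k::field) TT" where
  "tensor_power a n = basis (bar_of_word (replicate n a))"


section \<open>Free cumulants of a single variable\<close>

definition moment_series :: "('a::ring_1 \<Rightarrow> 'k::field) \<Rightarrow> 'a \<Rightarrow> 'k fps" where
  "moment_series \<phi> a = Abs_fps (\<lambda>n. if n = 0 then 1 else \<phi> (a ^ n))"

definition cumulant_series :: "(nat \<Rightarrow> 'k::field) \<Rightarrow> 'k fps" where
  "cumulant_series k = Abs_fps (\<lambda>n. if n = 0 then 1 else k n)"

definition free_cumulants :: "('a::ring_1 \<Rightarrow> 'k::field) \<Rightarrow> 'a \<Rightarrow> (nat \<Rightarrow> 'k) \<Rightarrow> bool" where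
  "free_cumulants \<phi> a k \<longleftrightarrow>
     fps_compose (cumulant_series k) (fps_X * moment_series \<phi> a) = moment_series \<phi> a"

end

theory Submission
  imports Defs
begin

text \<open>
  Evaluated on a single word \<open>a\<^sub>1\<dots>a\<^sub>n\<close>, the equation \<open>\<Phi> = e + \<kappa> \<prec> \<Phi>\<close> becomes the sum of
  \<open>\<kappa>(a\<^sub>S) \<Phi>(a\<^sub>J\<^sub>1|\<dots>|a\<^sub>J\<^sub>r)\<close> over all sets of positions \<open>S\<close> containing 1: the term \<open>b \<otimes> 1\<close> that
  \<open>\<Delta>\<^sub>\<prec>\<close> removes is exactly what the augmentation part of \<open>\<Phi>\<close> contributes (\<open>half_conv_word\<close>).

  If all letters equal \<open>a\<close>, the summand depends only on the size of \<open>S\<close> and on the lengths of the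
  runs of its complement, since \<open>\<Phi>\<close> is multiplicative and takes the value \<open>m\<^sub>l\<close> on a run of length
  \<open>l\<close>.  A set \<open>S = {1 = s\<^sub>1 < \<dots> < s\<^sub>p}\<close> is the same thing as the list of gap lengths
  \<open>i\<^sub>j = s\<^sub>j\<^sub>+\<^sub>1 - s\<^sub>j - 1\<close> (with \<open>s\<^sub>p\<^sub>+\<^sub>1 = n + 1\<close>), and these gaps add up to \<open>n - p\<close>
  (\<open>bij_betw_block_starts\<close>).  The runs of the complement are the nonempty gaps, and an empty gap
  contributes the factor \<open>m\<^sub>0 = 1\<close> (\<open>prod_runs_block_starts\<close>), so the moment recursion follows.
  Its right-hand side is the coefficient of \<open>z\<^sup>n\<close> in \<open>C(zM(z))\<close>, because \<open>(zM(z))\<^sup>s\<close> has there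
  the sum of \<open>m\<^sub>i\<^sub>1\<dots>m\<^sub>i\<^sub>s\<close> over all lists of length \<open>s\<close> with sum \<open>n - s\<close>.
\<close>

section \<open>Maximal runs\<close>

lemma finite_maximal_runs: "finite U \<Longrightarrow> finite (maximal_runs U)"
  by (rule finite_subset[of _ "Pow U"]) (auto simp: maximal_runs_def)

lemma maximal_runs_empty: "maximal_runs {} = {}"
  by (auto simp: maximal_runs_def is_run_def)

lemma maximal_runs_interval: "i \<le> j \<Longrightarrow> maximal_runs {i..j} = {{i..j}}"
  unfolding maximal_runs_def is_run_def by blast

lemma maximal_runs_nonempty:
  assumes "finite U" "U \<noteq> {}"
  shows "maximal_runs U \<noteq> {}"
proof -
  let ?R = "{J. is_run J \<and> J \<subseteq> U}"
  obtain x where "x \<in> U" using assms(2) by blast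
  moreover have "is_run {x..x}" unfolding is_run_def by blast
  ultimately have "{x..x} \<in> ?R" by simp
  moreover have "finite ?R"
    by (rule finite_subset[of _ "Pow U"]) (use assms(1) in auto)
  ultimately obtain J where "J \<in> ?R" "\<forall>J'\<in>?R. J \<subseteq> J' \<longrightarrow> J = J'"
    using finite_has_maximal[of ?R] by blast
  then have "J \<in> maximal_runs U"
    by (auto simp: maximal_runs_def)
  then show ?thesis by blast
qed

text \<open>Of two runs that start at the same position, one contains the other.\<close>

lemma inj_on_Min_maximal_runs: "inj_on Min (maximal_runs U)"
proof (rule inj_onI)
  fix J J' assume J: "J \<in> maximal_runs U" and J': "J' \<in> maximal_runs U" and eq: "Min J = Min J'"
  obtain i j i' j' where ij: "i \<le> j" "J = {i..j}" "i' \<le> j'" "J' = {i'..j'}"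
    using J J' by (auto simp: maximal_runs_def is_run_def)
  have "Min J = i" "Min J' = i'"
    unfolding ij by (rule Min_eqI; use ij in auto)+
  then have "J \<subseteq> J' \<or> J' \<subseteq> J" using eq ij by auto
  with J J' show "J = J'" by (auto simp: maximal_runs_def)
qed

lemma
  assumes "finite U"
  shows set_run_list: "set (run_list U) = maximal_runs U"
    and distinct_run_list: "distinct (run_list U)"
proof -
  interpret M: folding_insort_key "(\<le>)" "(<)" "maximal_runs U" Min
    by unfold_locales (rule inj_on_Min_maximal_runs)
  show "set (run_list U) = maximal_runs U"
    unfolding run_list_def linorder_class.sorted_key_list_of_set_dict
    by (rule M.set_sorted_key_list_of_set[OF order_refl finite_maximal_runs[OF assms]])
  have "distinct (map Min (run_list U))"
    unfolding run_list_def linorder_class.sorted_key_list_of_set_dict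
    by (rule M.distinct_sorted_key_list_of_set[OF order_refl])
  then show "distinct (run_list U)" by (simp add: distinct_map)
qed

lemma run_list_eq_Nil_iff: "finite U \<Longrightarrow> run_list U = [] \<longleftrightarrow> U = {}"
  by (metis maximal_runs_empty maximal_runs_nonempty set_run_list set_empty)

text \<open>
  No run can jump over the missing position \<open>Suc n\<close>, so the runs on its two sides do not interact.
\<close>

lemma maximal_runs_Un_separated:
  assumes U: "U \<subseteq> {..n}" and V: "V \<subseteq> {Suc (Suc n)..}"
  shows "maximal_runs (U \<union> V) = maximal_runs U \<union> maximal_runs V"
proof -
  have split: "J \<subseteq> U \<or> J \<subseteq> V" if "is_run J" "J \<subseteq> U \<union> V" for J
  proof -
    from that obtain i j where J: "i \<le> j" "J = {i..j}" by (auto simp: is_run_def)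
    have "Suc n \<notin> J" using that(2) U V by fastforce
    then have "j \<le> n \<or> Suc (Suc n) \<le> i" using J by auto
    then have "J \<inter> V = {} \<or> J \<inter> U = {}" using J U V by fastforce
    then show ?thesis using that(2) by blast
  qed
  have disj: "U \<inter> V = {}" using U V by fastforce
  have ne: "J \<noteq> {}" if "is_run J" for J
    using that by (auto simp: is_run_def)
  show ?thesis
  proof (intro equalityI subsetI)
    fix J assume J: "J \<in> maximal_runs (U \<union> V)"
    then have "J \<subseteq> U \<or> J \<subseteq> V" using split by (auto simp: maximal_runs_def)
    with J show "J \<in> maximal_runs U \<union> maximal_runs V"
      unfolding maximal_runs_def by blast
  next
    fix J assume J: "J \<in> maximal_runs U \<union> maximal_runs V"
    then have run: "is_run J" and sub: "J \<subseteq> U \<union> V" by (auto simp: maximal_runs_def)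
    have "J' = J" if "is_run J'" "J \<subseteq> J'" "J' \<subseteq> U \<union> V" for J'
    proof -
      have "J' \<subseteq> U \<or> J' \<subseteq> V" using split that by blast
      moreover have "J \<noteq> {}" using ne run .
      ultimately show ?thesis
        using J that disj unfolding maximal_runs_def by blast
    qed
    with run sub show "J \<in> maximal_runs (U \<union> V)" by (auto simp: maximal_runs_def)
  qed
qed

section \<open>Sets of positions and their gaps\<close>

text \<open>
  The set \<open>{s\<^sub>1 < \<dots> < s\<^sub>p}\<close> with \<open>s\<^sub>1 = 1\<close> in which \<open>s\<^sub>j\<close> is followed by a gap of length \<open>is ! (j - 1)\<close>.
\<close>

definition block_starts :: "nat list \<Rightarrow> nat set" where
  "block_starts is = (\<lambda>j. Suc (j + sum_list (take j is))) ` {..<length is}"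

lemma block_starts_Nil [simp]: "block_starts [] = {}"
  by (simp add: block_starts_def)

text \<open>
  Appending a gap adds one new largest position, which makes induction from the right possible.
\<close>

lemma block_starts_snoc [simp]:
  "block_starts (is @ [i]) = insert (Suc (length is + sum_list is)) (block_starts is)"
  by (simp add: block_starts_def lessThan_Suc)

lemma finite_block_starts: "finite (block_starts is)"
  by (simp add: block_starts_def)

lemma block_starts_subset: "block_starts is \<subseteq> {1..length is + sum_list is}"
  by (induction "is" rule: rev_induct) auto

lemma card_block_starts: "card (block_starts is) = length is"
proof (induction "is" rule: rev_induct)
  case (snoc i "is")
  have "Suc (length is + sum_list is) \<notin> block_starts is"
    using block_starts_subset[of "is"] by auto
  then show ?case using snoc by (simp add: finite_block_starts)
qed simp

lemma one_in_block_starts: "is \<noteq> [] \<Longrightarrow> 1 \<in> block_starts is"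
  by (auto simp: block_starts_def image_iff intro!: bexI[of _ 0])

text \<open>
  The largest position determines the total length covered by all positions and gaps before it, so
  the induction hypothesis recovers those gaps; the last gap is then what remains of the total.
\<close>

lemma block_starts_inject:
  assumes "block_starts is = block_starts js"
    and "length is + sum_list is = length js + sum_list js"
  shows "is = js"
  using assms
proof (induction "is" arbitrary: js rule: rev_induct)
  case Nil
  then show ?case by (metis block_starts_Nil one_in_block_starts empty_iff)
next
  case (snoc i "is")
  have "js \<noteq> []" using snoc.prems(1) by auto
  then obtain j js' where js: "js = js' @ [j]" by (metis rev_exhaust)
  have max: "Max (block_starts (xs @ [x])) = Suc (length xs + sum_list xs)" for xs and x :: nat
    by (rule Max_eqI) (use block_starts_subset[of xs] in \<open>auto simp: finite_block_starts\<close>)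
  have eq: "length is + sum_list is = length js' + sum_list js'"
    using snoc.prems(1) max[of "is" i] max[of js' j] js by simp
  have "Suc (length is + sum_list is) \<notin> block_starts is"
       "Suc (length is + sum_list is) \<notin> block_starts js'"
    using block_starts_subset[of "is"] block_starts_subset[of js'] eq by auto
  then have "block_starts is = block_starts js'"
    using snoc.prems(1) js eq by (simp add: insert_ident)
  then have "is = js'" using snoc.IH eq by blast
  then show ?case using snoc.prems(2) js by simp
qed

lemma block_starts_surj:
  assumes "S \<subseteq> {1..n}" "n > 0 \<Longrightarrow> 1 \<in> S"
  shows "\<exists>is. block_starts is = S \<and> length is + sum_list is = n"
  using assms
proof (induction n arbitrary: S rule: less_induct)
  case (less n)
  show ?case
  proof (cases "n = 0")
    case True
    then show ?thesis using less.prems by (intro exI[of _ "[]"]) auto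
  next
    case False
    define s where "s = Max S"
    have fin: "finite S" using less.prems(1) finite_subset by blast
    have 1: "1 \<in> S" using less.prems(2) False by simp
    then have s: "s \<in> S" "\<And>t. t \<in> S \<Longrightarrow> t \<le> s"
      using fin unfolding s_def by (auto intro: Max_in)
    have sn: "1 \<le> s" "s \<le> n" using s(1) less.prems(1) by auto
    have sub: "S - {s} \<subseteq> {1..s - 1}"
    proof
      fix t assume t: "t \<in> S - {s}"
      then have "t \<le> s" "t \<noteq> s" "1 \<le> t" using s(2) less.prems(1) by auto
      then show "t \<in> {1..s - 1}" by simp
    qed
    have one: "1 \<in> S - {s}" if "s - 1 > 0" using that 1 by auto
    have "s - 1 < n" using sn by simp
    from less.IH[OF this sub one] obtain "is" where "is": "block_starts is = S - {s}" "length is + sum_list is = s - 1"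
      by blast
    have "block_starts (is @ [n - s]) = S" using "is" s(1) sn by auto
    moreover have "length (is @ [n - s]) + sum_list (is @ [n - s]) = n"
      using "is" sn by simp
    ultimately show ?thesis by blast
  qed
qed

lemma bij_betw_block_starts:
  assumes "n \<ge> 1"
  shows "bij_betw block_starts {is. length is + sum_list is = n} {S. 1 \<in> S \<and> S \<subseteq> {1..n}}"
  unfolding bij_betw_def
proof (intro conjI)
  show "inj_on block_starts {is. length is + sum_list is = n}"
    by (auto intro!: inj_onI block_starts_inject)
  have "1 \<in> block_starts is" "block_starts is \<subseteq> {1..n}" if "length is + sum_list is = n" for "is"
  proof -
    have "is \<noteq> []" using that assms by auto
    then show "1 \<in> block_starts is" by (rule one_in_block_starts)
    show "block_starts is \<subseteq> {1..n}" using block_starts_subset[of "is"] that by simp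
  qed
  moreover have "S \<in> block_starts ` {is. length is + sum_list is = n}"
    if "1 \<in> S" "S \<subseteq> {1..n}" for S
    using block_starts_surj[of S n] that by blast
  ultimately show "block_starts ` {is. length is + sum_list is = n} = {S. 1 \<in> S \<and> S \<subseteq> {1..n}}"
    by blast
qed

text \<open>
  The runs of the complement are the nonempty gaps; the condition on \<open>f 0\<close> makes the empty gaps
  invisible in the product.
\<close>

lemma prod_runs_block_starts:
  fixes f :: "nat \<Rightarrow> 'b::comm_monoid_mult"
  assumes f0: "f 0 = 1"
  shows "(\<Prod>J\<in>maximal_runs ({1..length is + sum_list is} - block_starts is). f (card J)) =
         prod_list (map f is)"
proof (induction "is" rule: rev_induct)
  case Nil
  then show ?case by (simp add: maximal_runs_empty)
next
  case (snoc i "is")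
  define n where "n = length is + sum_list is"
  define U where "U = {1..n} - block_starts is"
  define V where "V = {Suc (Suc n)..Suc n + i}"
  have sub: "block_starts is \<subseteq> {1..n}"
    using block_starts_subset[of "is"] by (simp add: n_def)
  have split: "{1..length (is @ [i]) + sum_list (is @ [i])} - block_starts (is @ [i]) = U \<union> V"
    using sub by (auto simp: U_def V_def n_def)
  have UV: "U \<subseteq> {..n}" "V \<subseteq> {Suc (Suc n)..}" by (auto simp: U_def V_def)
  have disj: "maximal_runs U \<inter> maximal_runs V = {}"
  proof -
    have "U \<inter> V = {}" by (auto simp: U_def V_def)
    then have "J = {}" if "J \<in> maximal_runs U" "J \<in> maximal_runs V" for J
      using that unfolding maximal_runs_def by blast
    moreover have "{} \<notin> maximal_runs U" by (auto simp: maximal_runs_def is_run_def)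
    ultimately show ?thesis by blast
  qed
  have V: "(\<Prod>J\<in>maximal_runs V. f (card J)) = f i"
  proof (cases "i = 0")
    case True
    then show ?thesis using f0 by (simp add: V_def maximal_runs_empty)
  next
    case False
    then have "maximal_runs V = {V}"
      unfolding V_def by (intro maximal_runs_interval) simp
    then show ?thesis by (simp add: V_def)
  qed
  have "(\<Prod>J\<in>maximal_runs (U \<union> V). f (card J)) =
        (\<Prod>J\<in>maximal_runs U. f (card J)) * (\<Prod>J\<in>maximal_runs V. f (card J))"
    unfolding maximal_runs_Un_separated[OF UV]
    by (rule prod.union_disjoint) (use disj in \<open>auto intro!: finite_maximal_runs simp: U_def V_def\<close>)
  also have "\<dots> = prod_list (map f is) * f i"
    using snoc V by (simp add: U_def n_def)
  finally show ?case unfolding split by simp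
qed

section \<open>The half-convolution on a single word\<close>

lemma one_eq_basis_Nil: "(1 :: ('a, 'k::field) TT) = basis []"
  by (simp add: basis_def flip: zero_list_def)

lemma coproduct_basis_Nil: "coproduct (basis []) = 1"
  by (simp add: coproduct_def lin_ext_basis[OF vector_space_free_scale])

lemma coproduct_prec_plus_word:
  "coproduct_prec_plus (basis [basis (Word w)] :: ('a, 'k::field) TT) =
     (\<Sum>S | 1 \<in> S \<and> S \<subseteq> {1..length w}. coproduct_term w S)" if "w \<noteq> []"
  using that
  by (simp add: coproduct_prec_plus_def coproduct_prec_plus_T_def coproduct_basis_Nil
      lin_ext_basis[OF vector_space_free_scale] Word_inverse)

lemma tensor_form_basis: "tensor_form f g (basis (u, v)) = f (basis u) * g (basis v)"
  by (simp add: tensor_form_def lin_ext_basis[OF vector_space_mult])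

lemma subword_whole: "subword w {1..length w} = w"
proof -
  have "sorted_list_of_set {1..length w} = [1..<Suc (length w)]"
    by (metis atLeastLessThanSuc_atLeastAtMost sorted_list_of_set_range)
  then show ?thesis
    unfolding subword_def by (intro nth_equalityI) (auto simp del: upt_Suc)
qed

text \<open>
  Write \<open>g\<close> as \<open>e\<close> plus a form vanishing on \<open>1\<close>.  The latter differs from \<open>g\<close> only on the empty
  bar-word, which is the right factor of the term \<open>S = {1..length w}\<close> alone; the
  deficit there is made up for by \<open>f \<prec> e = f\<close>.
\<close>

lemma half_conv_word:
  fixes f g :: "('a, 'k::field) TT \<Rightarrow> 'k"
  assumes g1: "g 1 = 1" and w: "w \<noteq> []"
  shows "half_conv f g (basis [basis (Word w)]) =
    (\<Sum>S | 1 \<in> S \<and> S \<subseteq> {1..length w}.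
       f (basis (bar_of_word (subword w S))) *
       g (basis (map (\<lambda>J. basis (Word (subword w J))) (run_list ({1..length w} - S)))))"
    (is "_ = (\<Sum>S\<in>?P. ?F S * g (?G S))")
proof -
  define b where "b = (basis [basis (Word w)] :: ('a, 'k) TT)"
  define g' where "g' = (\<lambda>c. g c - augmentation c)"
  let ?N = "{1..length w}"
  interpret l: Vector_Spaces.linear free_scale "(*)" "tensor_form f g'"
    unfolding tensor_form_def by (rule linear_lin_ext[OF vector_space_mult])
  have g': "g' (basis vs) = g (basis vs) - (if vs = [] then 1 else 0)" for vs
    by (simp add: g'_def g1 augmentation_def basis_def lookup_single)
  have "proj_plus b = b"
    by (rule poly_mapping_eqI)
      (simp add: proj_plus_def b_def augmentation_def basis_def lookup_single lookup_minus)
  moreover have "tensor_form f g' (coproduct_prec b) =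
    (\<Sum>S\<in>?P. tensor_form f g' (coproduct_term w S)) - f b * g' (basis [])"
    unfolding coproduct_prec_def b_def coproduct_prec_plus_word[OF w] l.diff l.sum
    by (simp add: lin_ext_basis[OF vector_space_free_scale] tensor_form_basis)
  moreover have "g' (basis []) = 0"
    using g1 by (simp add: g' one_eq_basis_Nil)
  ultimately have "half_conv f g b = f b + (\<Sum>S\<in>?P. tensor_form f g' (coproduct_term w S))"
    by (simp add: half_conv_def half_conv0_def g1 flip: g'_def)
  also have "(\<Sum>S\<in>?P. tensor_form f g' (coproduct_term w S)) =
      (\<Sum>S\<in>?P. ?F S * g (?G S) - (if S = ?N then ?F ?N else 0))"
  proof (rule sum.cong[OF refl])
    fix S assume "S \<in> ?P"
    then have "run_list (?N - S) = [] \<longleftrightarrow> S = ?N"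
      by (auto simp: run_list_eq_Nil_iff)
    then show "tensor_form f g' (coproduct_term w S) =
        ?F S * g (?G S) - (if S = ?N then ?F ?N else 0)"
      by (auto simp: coproduct_term_def tensor_form_basis g' algebra_simps)
  qed
  also have "\<dots> = (\<Sum>S\<in>?P. ?F S * g (?G S)) - ?F ?N"
  proof -
    have "?N \<in> ?P" using w by (cases w) auto
    moreover have "finite ?P" by (rule finite_subset[of _ "Pow ?N"]) auto
    ultimately show ?thesis by (simp add: sum_subtractf sum.delta')
  qed
  also have "?F ?N = f b"
    using w by (simp only: subword_whole) (simp add: b_def bar_of_word_def)
  finally show ?thesis by (simp add: b_def)
qed

section \<open>Words with equal letters\<close>

lemma subword_replicate:
  assumes "S \<subseteq> {1..n}"
  shows "subword (replicate n a) S = replicate (card S) a"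
proof -
  have fin: "finite S" using assms finite_subset by blast
  have "map (\<lambda>i. replicate n a ! (i - 1)) (sorted_list_of_set S) = map (\<lambda>i. a) (sorted_list_of_set S)"
    by (rule map_cong[OF refl]) (use fin assms in \<open>fastforce intro!: nth_replicate\<close>)
  then show ?thesis using fin by (simp add: subword_def map_replicate_const)
qed

lemma multiplicative_extension_basis:
  "multiplicative_extension \<phi> (basis ws) = prod_list (map (extend_T \<phi>) ws)"
  by (simp add: multiplicative_extension_def lin_ext_basis[OF vector_space_mult])

lemma extend_T_word: "w \<noteq> [] \<Longrightarrow> extend_T \<phi> (basis (Word w)) = \<phi> (prod_list w)"
  by (simp add: extend_T_def lin_ext_basis[OF vector_space_mult] Word_inverse)

lemma multiplicative_extension_tensor_power:
  assumes "\<phi> 1 = 1"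
  shows "multiplicative_extension \<phi> (tensor_power a n) = \<phi> (a ^ n)"
  using assms
  by (simp add: tensor_power_def bar_of_word_def multiplicative_extension_basis extend_T_word)

lemma multiplicative_extension_runs:
  assumes "finite U" "U \<subseteq> {1..n}"
  shows "multiplicative_extension \<phi>
      (basis (map (\<lambda>J. basis (Word (subword (replicate n a) J))) (run_list U))) =
    (\<Prod>J\<in>maximal_runs U. \<phi> (a ^ card J))"
proof -
  have "extend_T \<phi> (basis (Word (subword (replicate n a) J))) = \<phi> (a ^ card J)"
    if "J \<in> maximal_runs U" for J
  proof -
    have "J \<subseteq> U" "is_run J" using that by (auto simp: maximal_runs_def)
    then have "J \<subseteq> {1..n}" "card J \<noteq> 0" using assms(2) by (auto simp: is_run_def)
    then show ?thesis by (simp add: subword_replicate extend_T_word)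
  qed
  then have "map (\<lambda>J. extend_T \<phi> (basis (Word (subword (replicate n a) J)))) (run_list U) =
      map (\<lambda>J. \<phi> (a ^ card J)) (run_list U)"
    by (intro map_cong refl) (simp add: set_run_list[OF assms(1)])
  then show ?thesis
    by (simp add: multiplicative_extension_basis comp_def set_run_list[OF assms(1)]
        prod.distinct_set_conv_list[OF distinct_run_list[OF assms(1)], symmetric])
qed

lemma half_conv_tensor_power:
  fixes \<kappa> :: "('a::ring_1, 'k::field) TT \<Rightarrow> 'k"
  assumes \<phi>1: "\<phi> 1 = 1" and n: "n \<ge> 1"
  shows "half_conv \<kappa> (multiplicative_extension \<phi>) (tensor_power a n) =
    (\<Sum>s = 1..n. \<Sum>is | length is = s \<and> sum_list is = n - s.
       \<kappa> (tensor_power a s) * prod_list (map (\<lambda>i. \<phi> (a ^ i)) is))"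
proof -
  let ?P = "{S. 1 \<in> S \<and> S \<subseteq> {1..n}}"
  let ?L = "{is. length is + sum_list is = n}"
  let ?t = "\<lambda>is. \<kappa> (tensor_power a (length is)) * prod_list (map (\<lambda>i. \<phi> (a ^ i)) is)"
  have "half_conv \<kappa> (multiplicative_extension \<phi>) (tensor_power a n) =
    (\<Sum>S\<in>?P. \<kappa> (tensor_power a (card S)) * (\<Prod>J\<in>maximal_runs ({1..n} - S). \<phi> (a ^ card J)))"
  proof -
    have "multiplicative_extension \<phi> 1 = 1"
      by (simp add: one_eq_basis_Nil multiplicative_extension_basis)
    from half_conv_word[where w = "replicate n a" and f = \<kappa> and g = "multiplicative_extension \<phi>", OF this] n show ?thesis
      by (auto simp: tensor_power_def bar_of_word_def[of "replicate n a"] subword_replicate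
          multiplicative_extension_runs intro!: sum.cong)
  qed
  also have "\<dots> = (\<Sum>is\<in>?L. ?t is)"
  proof (rule sum.reindex_bij_betw[OF bij_betw_block_starts[OF n], symmetric, THEN trans],
      rule sum.cong[OF refl])
    fix "is" assume "is \<in> ?L"
    then have "(\<Prod>J\<in>maximal_runs ({1..n} - block_starts is). \<phi> (a ^ card J)) =
        prod_list (map (\<lambda>i. \<phi> (a ^ i)) is)"
      using prod_runs_block_starts[of "\<lambda>i. \<phi> (a ^ i)" "is"] \<phi>1 by auto
    then show "\<kappa> (tensor_power a (card (block_starts is))) *
        (\<Prod>J\<in>maximal_runs ({1..n} - block_starts is). \<phi> (a ^ card J)) = ?t is"
      by (simp add: card_block_starts)
  qed
  also have "\<dots> = (\<Sum>s = 1..n. \<Sum>is | is \<in> ?L \<and> length is = s. ?t is)"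
  proof (rule sum.group[symmetric])
    have "finite {S. 1 \<in> S \<and> S \<subseteq> {1..n}}" by (rule finite_subset[of _ "Pow {1..n}"]) auto
    then show "finite ?L" using bij_betw_finite[OF bij_betw_block_starts[OF n]] by simp
    show "length ` ?L \<subseteq> {1..n}"
    proof safe
      fix "is" :: "nat list" assume "n = length is + sum_list is"
      with n show "length is \<in> {1..length is + sum_list is}" by (cases "is") auto
    qed
  qed simp
  also have "\<dots> = (\<Sum>s = 1..n. \<Sum>is | length is = s \<and> sum_list is = n - s.
       \<kappa> (tensor_power a s) * prod_list (map (\<lambda>i. \<phi> (a ^ i)) is))"
    by (intro sum.cong) auto
  finally show ?thesis .
qed

section \<open>The functional equation of the free cumulants\<close>

lemma fps_power_nth_sum_list:
  includes fps_syntax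
  fixes f :: "'k::comm_ring_1 fps"
  shows "(f ^ s) $ n = (\<Sum>is | length is = s \<and> sum_list is = n. prod_list (map (fps_nth f) is))"
proof (cases s)
  case 0
  have "{is :: nat list. is = [] \<and> sum_list is = n} = (if n = 0 then {[]} else {})" by auto
  with 0 show ?thesis by simp
next
  case (Suc r)
  have "(\<Prod>j = 0..r. f $ (is ! j)) = prod_list (map (fps_nth f) is)" if "length is = s" for "is"
    using that Suc
    by (simp add: prod.list_conv_set_nth atLeastLessThanSuc_atLeastAtMost)
  then show ?thesis
    unfolding Suc fps_power_nth_Suc using Suc by (auto simp: natpermute_def intro!: sum.cong)
qed

lemma free_cumulantsI:
  includes fps_syntax
  fixes k :: "nat \<Rightarrow> 'k::field"
  assumes \<phi>1: "\<phi> 1 = 1"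
    and rec: "\<And>n. n \<ge> 1 \<Longrightarrow> \<phi> (a ^ n) =
      (\<Sum>s = 1..n. \<Sum>is | length is = s \<and> sum_list is = n - s. k s * prod_list (map (\<lambda>i. \<phi> (a ^ i)) is))"
  shows "free_cumulants \<phi> a k"
  unfolding free_cumulants_def
proof (rule fps_ext)
  fix n
  let ?M = "moment_series \<phi> a" and ?C = "cumulant_series k"
  have M: "fps_nth ?M = (\<lambda>i. \<phi> (a ^ i))"
    using \<phi>1 by (auto simp: moment_series_def fun_eq_iff)
  show "(?C oo fps_X * ?M) $ n = ?M $ n"
  proof (cases "n = 0")
    case True
    then show ?thesis by (simp add: moment_series_def cumulant_series_def)
  next
    case False
    have "(?C oo fps_X * ?M) $ n = (\<Sum>s = 0..n. ?C $ s * (?M ^ s) $ (n - s))"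
      by (auto simp: fps_compose_nth power_mult_distrib fps_X_power_mult_nth intro!: sum.cong)
    \<comment> \<open>For \<open>s = 0\<close> the coefficient is that of \<open>z\<^sup>n\<close> in the constant series \<open>1\<close>.\<close>
    also have "\<dots> = (\<Sum>s = 1..n. k s * (?M ^ s) $ (n - s))"
      using False by (simp add: sum.atLeast_Suc_atMost cumulant_series_def)
    also have "\<dots> = \<phi> (a ^ n)"
      using False by (simp add: rec[of n] fps_power_nth_sum_list M sum_distrib_left)
    finally show ?thesis by (simp add: M)
  qed
qed

section \<open>The moment recursion\<close>

theorem theorem8:
  fixes scale :: "'k::field_char_0 \<Rightarrow> 'a::ring_1 \<Rightarrow> 'a"
    and \<phi> :: "'a \<Rightarrow> 'k"
    and \<Phi> \<kappa> :: "('a, 'k) TT \<Rightarrow> 'k"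
    and a :: 'a
    and k m :: "nat \<Rightarrow> 'k"
  assumes "unital_algebra scale"
    and "Vector_Spaces.linear scale (*) \<phi>"
    and "\<phi> 1 = 1"
    and "\<Phi> = multiplicative_extension \<phi>"
    and "infinitesimal_character scale \<kappa>"
    and "\<Phi> = (\<lambda>b. augmentation b + half_conv \<kappa> \<Phi> b)"
    and "\<And>n. n \<ge> 1 \<Longrightarrow> k n = \<kappa> (tensor_power a n)"
    and "\<And>n. m n = \<Phi> (tensor_power a n)"
  shows "(\<forall>n. m n = \<phi> (a ^ n)) \<and>
    (\<forall>n\<ge>1. m n = (\<Sum>s = 1..n. \<Sum>is | length is = s \<and> sum_list is = n - s.
                     k s * prod_list (map m is))) \<and>
    free_cumulants \<phi> a k"
proof -
  have \<phi>1: "\<phi> 1 = 1" by fact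
  have m: "m n = \<phi> (a ^ n)" for n
    using assms(4,8) by (simp add: multiplicative_extension_tensor_power \<phi>1)
  then have m_fun: "m = (\<lambda>n. \<phi> (a ^ n))" by blast
  have rec: "m n = (\<Sum>s = 1..n. \<Sum>is | length is = s \<and> sum_list is = n - s.
      k s * prod_list (map m is))" if "n \<ge> 1" for n
  proof -
    have "augmentation (tensor_power a n :: ('a, 'k) TT) = 0"
      using that by (simp add: augmentation_def tensor_power_def bar_of_word_def basis_def lookup_single)
    then have "m n = half_conv \<kappa> (multiplicative_extension \<phi>) (tensor_power a n)"
      using fun_cong[OF assms(6), of "tensor_power a n"] assms(4,8) by simp
    also have "\<dots> = (\<Sum>s = 1..n. \<Sum>is | length is = s \<and> sum_list is = n - s.
        \<kappa> (tensor_power a s) * prod_list (map m is))"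
      using half_conv_tensor_power[where \<phi> = \<phi>, OF \<phi>1 that] m by presburger
    also have "\<dots> = (\<Sum>s = 1..n. \<Sum>is | length is = s \<and> sum_list is = n - s.
        k s * prod_list (map m is))"
      using assms(7) by simp
    finally show ?thesis .
  qed
  have "free_cumulants \<phi> a k"
    by (rule free_cumulantsI) (use \<phi>1 rec[unfolded m_fun] in auto)
  with m rec show ?thesis by blast
qed

end
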